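(* Let $G$ and $G'$ be two graphs on the same set $V$ of $v$ vertices. Let $p$ be a prime number and $k$ an integer with $4\leq k\leq v-4$. 1) If $p^{(4)}(G_{\restriction K})=p^{(4)}(G'_{\restriction K})$ for all $k$-element subsets $K$ of $V$, then $G$ and $G'$ have the same indecomposable sets of size $4$. 2) Assume $p^{(4)}(G_{\restriction K})\equiv p^{(4)}(G'_{\restriction K}) \pmod p$ for all $k$-element subsets $K$ of $V$. a) If $p\geq 5$ and $k\not\equiv 1,2,3 \pmod p$, then $G$ and $G'$ have the same indecomposable sets of size $4$. b) If ($p=2$, $4\mid k$ and $8\nmid k$) or ($p=3$, $3\mid k-1$ and $9\nmid k-1$), then $G$ and $G'$ have the same indecomposable sets of size $4$. c) If $p=2$ and $8\mid k$, then $G$ and $G'$ have the same indecomposable sets of size $4$, or for all $4$-element subsets $T$ of $V$, $G_{\restriction T}$ is indecomposable if and only if $G'_{\restriction T}$ is decomposable.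
   Context: Graphs are simple undirected graphs; $G_{\restriction K}$ is the induced subgraph on $K$. A subset $I$ of the vertex set of a graph is an interval if for all $a,b\in I$ and all vertices $x\notin I$, $\{a,x\}$ is an edge iff $\{b,x\}$ is an edge. The sets $\emptyset$, singletons and the whole vertex set are trivial intervals; a graph is indecomposable if all its intervals are trivial, decomposable otherwise. An indecomposable set of size $4$ of $G$ is a $4$-element subset $T$ with $G_{\restriction T}$ indecomposable (equivalently, $G_{\restriction T}$ isomorphic to the path $P_4$ with edges $\{0,1\},\{1,2\},\{2,3\}$). $p^{(4)}(G)$ denotes the number of $4$-element subsets $T$ of the vertex set with $G_{\restriction T}$ indecomposable. *)

theory Defs
  imports
    "Graph_Theory.Digraph_Component"
    "HOL-Number_Theory.Cong"
begin

text \<open>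
  Graphs are the finite simple graphs of Graph\_Theory (\<^locale>\<open>graph\<close>): finite loop-free
  digraphs without parallel arcs whose arc relation is symmetric, so that the pair of vertices
  $\{u, v\}$ is an edge iff \<open>u \<rightarrow>\<^bsub>G\<^esub> v\<close>, equivalently \<open>v \<rightarrow>\<^bsub>G\<^esub> u\<close>. The induced
  subgraph is \<open>G \<restriction> K\<close>.
\<close>

definition interval :: "('a, 'b) pre_digraph \<Rightarrow> 'a set \<Rightarrow> bool" where
  "interval G I \<longleftrightarrow> I \<subseteq> verts G \<and>
    (\<forall>a\<in>I. \<forall>b\<in>I. \<forall>x\<in>verts G - I. a \<rightarrow>\<^bsub>G\<^esub> x \<longleftrightarrow> b \<rightarrow>\<^bsub>G\<^esub> x)"

definition trivial_interval :: "('a, 'b) pre_digraph \<Rightarrow> 'a set \<Rightarrow> bool" where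
  "trivial_interval G I \<longleftrightarrow> I = {} \<or> (\<exists>x\<in>verts G. I = {x}) \<or> I = verts G"

definition indecomposable :: "('a, 'b) pre_digraph \<Rightarrow> bool" where
  "indecomposable G \<longleftrightarrow> (\<forall>I. interval G I \<longrightarrow> trivial_interval G I)"

abbreviation decomposable :: "('a, 'b) pre_digraph \<Rightarrow> bool" where
  "decomposable G \<equiv> \<not> indecomposable G"

definition indecomposable_sets4 :: "('a, 'b) pre_digraph \<Rightarrow> 'a set set" where
  "indecomposable_sets4 G = {T. T \<subseteq> verts G \<and> card T = 4 \<and> indecomposable (G \<restriction> T)}"

definition p4 :: "('a, 'b) pre_digraph \<Rightarrow> nat" where
  "p4 G = card (indecomposable_sets4 G)"

end

theory Submission
  imports Defs
begin

text \<open>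
  Let \<open>f\<close> be the difference of the indicators of the indecomposable 4-sets of the two graphs; its
  sums over the 4-subsets of each \<open>k\<close>-set vanish modulo \<open>p\<close>. For \<open>a \<noteq> b\<close> the function
  \<open>U \<mapsto> f (U \<union> {a}) - f (U \<union> {b})\<close> on \<open>V - {a, b}\<close> satisfies the same hypothesis with
  \<open>(t, k)\<close> replaced by \<open>(t - 1, k - 1)\<close>. Induction on \<open>t\<close> therefore shows that \<open>f\<close> is constant
  modulo \<open>p\<close> as soon as \<open>p\<close> divides none of the binomials \<open>k - i\<close> over \<open>t - i\<close> for
  \<open>1 \<le> i \<le> t\<close>, and zero if this also holds for \<open>i = 0\<close>. This settles b) and c). In a), where
  \<open>p \<ge> 5\<close>, a nonzero constant would make all 4-sets of one graph indecomposable, which is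
  impossible since some three vertices form a triangle or an independent set. Part 1) is an
  instance of a) for a prime exceeding \<open>k\<close>.
\<close>

section \<open>Sums over subsets of fixed size and the exchange argument\<close>

text \<open>Splitting by membership of \<open>a\<close> isolates a part that depends on
  \<open>S\<close> only; it cancels when the sums for \<open>insert a S\<close> and
  \<open>insert b S\<close> are compared.\<close>

lemma sum_subsets_insert:
  fixes f :: "'a set \<Rightarrow> 'b::comm_monoid_add"
  assumes "finite S" "a \<notin> S"
  shows "(\<Sum>T | T \<subseteq> insert a S \<and> card T = Suc t. f T) =
    (\<Sum>T | T \<subseteq> S \<and> card T = Suc t. f T) + (\<Sum>T | T \<subseteq> S \<and> card T = t. f (insert a T))"
proof -
  let ?A = "{T. T \<subseteq> S \<and> card T = Suc t}" and ?B = "{T. T \<subseteq> S \<and> card T = t}"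
  have fin: "finite ?A" "finite ?B"
    using assms(1) by auto
  have "{T. T \<subseteq> insert a S \<and> card T = Suc t} = ?A \<union> insert a ` ?B" (is "?L = ?R")
  proof
    show "?L \<subseteq> ?R"
    proof
      fix T assume T: "T \<in> ?L"
      show "T \<in> ?R"
      proof (cases "a \<in> T")
        case True
        then have "T = insert a (T - {a})" "T - {a} \<in> ?B"
          using T by auto
        then show ?thesis by blast
      next
        case False
        then show ?thesis using T by auto
      qed
    qed
    have "card (insert a T) = Suc (card T)" if "T \<subseteq> S" for T
      using that assms finite_subset by (metis card_insert_disjoint subset_iff)
    then show "?R \<subseteq> ?L" by auto
  qed
  moreover have "?A \<inter> insert a ` ?B = {}"
    using assms(2) by auto
  moreover have "inj_on (insert a) ?B"
  proof (rule inj_onI)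
    fix T U assume "T \<in> ?B" "U \<in> ?B" "insert a T = insert a U"
    moreover from this have "a \<notin> T" "a \<notin> U"
      using assms(2) by blast+
    ultimately show "T = U"
      using insert_ident by metis
  qed
  ultimately show ?thesis
    using fin by (simp add: sum.union_disjoint sum.reindex)
qed

text \<open>Swapping some \<open>a\<close> in \<open>A - B\<close> for some \<open>b\<close> in
  \<open>B - A\<close> keeps the cardinality and shrinks \<open>A - B\<close>, so finitely many
  exchanges lead from \<open>A\<close> to \<open>B\<close>.\<close>

lemma cong_on_subsets_if_exchange:
  fixes f :: "'a set \<Rightarrow> int"
  assumes "finite V" "A \<subseteq> V" "B \<subseteq> V" "card A = card B"
    and exchange: "\<And>a b U. a \<in> V \<Longrightarrow> b \<in> V \<Longrightarrow> a \<noteq> b \<Longrightarrow> U \<subseteq> V - {a, b} \<Longrightarrow>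
      Suc (card U) = card B \<Longrightarrow> [f (insert a U) = f (insert b U)] (mod p)"
  shows "[f A = f B] (mod p)"
  using assms(2,4)
proof (induction "card (A - B)" arbitrary: A rule: less_induct)
  case less
  have fin: "finite A" "finite B"
    using less.prems assms(1,3) finite_subset by auto
  show ?case
  proof (cases "A \<subseteq> B")
    case True
    then have "A = B"
      using card_subset_eq[OF fin(2)] less.prems(2) by blast
    then show ?thesis by simp
  next
    case False
    then obtain a where a: "a \<in> A" "a \<notin> B" by blast
    have "\<not> B \<subseteq> A"
      using a card_subset_eq[OF fin(1)] less.prems(2)[symmetric] by blast
    then obtain b where b: "b \<in> B" "b \<notin> A" by blast
    let ?A' = "insert b (A - {a})"
    have card_A: "Suc (card (A - {a})) = card A"
      by (rule card_Suc_Diff1[OF fin(1) a(1)])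
    have "[f (insert a (A - {a})) = f ?A'] (mod p)"
    proof (rule exchange)
      show "a \<in> V" "b \<in> V" "a \<noteq> b" "A - {a} \<subseteq> V - {a, b}"
        using a b less.prems(1) assms(3) by blast+
      show "Suc (card (A - {a})) = card B"
        using card_A less.prems(2) by simp
    qed
    then have "[f A = f ?A'] (mod p)"
      using insert_Diff[OF a(1)] by metis
    moreover have "[f ?A' = f B] (mod p)"
    proof (rule less.hyps)
      have "?A' - B = (A - B) - {a}"
        using b(1) by blast
      then show "card (?A' - B) < card (A - B)"
        using card_Diff1_less[of "A - B" a] a fin(1) by simp
      show "?A' \<subseteq> V"
        using b less.prems(1) assms(3) by blast
      show "card ?A' = card B"
        using b(2) fin(1) card_A less.prems(2) by simp
    qed
    ultimately show ?thesis by (rule cong_trans)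
  qed
qed

lemma sum_subsets_cong_const:
  fixes f :: "'a set \<Rightarrow> int"
  assumes "finite K" "\<And>T. T \<subseteq> K \<Longrightarrow> card T = t \<Longrightarrow> [f T = c] (mod p)"
  shows "[(\<Sum>T | T \<subseteq> K \<and> card T = t. f T) = int (card K choose t) * c] (mod p)"
proof -
  have "[(\<Sum>T | T \<subseteq> K \<and> card T = t. f T) = (\<Sum>T | T \<subseteq> K \<and> card T = t. c)] (mod p)"
    by (rule cong_sum) (use assms(2) in auto)
  then show ?thesis
    using assms(1) by (simp add: n_subsets)
qed

text \<open>This concerns the kernel modulo \<open>p\<close> of the inclusion matrix of
  \<open>t\<close>-subsets versus \<open>k\<close>-subsets. Passing to \<open>V - {a, b}\<close>
  costs two points while \<open>k\<close> and \<open>t\<close> drop by one each, so the bound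
  \<open>k + t \<le> card V\<close> survives the induction.\<close>

lemma inclusion_kernel_cong_const:
  fixes f :: "'a set \<Rightarrow> int" and p :: int
  assumes "prime p" "finite V" "t \<le> k" "k + t \<le> card V"
    and "\<And>i. 1 \<le> i \<Longrightarrow> i \<le> t \<Longrightarrow> \<not> p dvd int ((k - i) choose (t - i))"
    and "\<And>K. K \<subseteq> V \<Longrightarrow> card K = k \<Longrightarrow> p dvd (\<Sum>T | T \<subseteq> K \<and> card T = t. f T)"
    and "A \<subseteq> V" "B \<subseteq> V" "card A = t" "card B = t"
  shows "[f A = f B] (mod p)"
  using assms(2-)
proof (induction t arbitrary: k V f A B)
  case 0
  then have "A = {}" "B = {}"
    by (meson card_0_eq finite_subset)+
  then show ?case by simp
next
  case (Suc t)
  obtain l where k: "k = Suc l" "t \<le> l"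
    using Suc.prems(2) by (cases k) auto
  have exchange: "[f (insert a U) = f (insert b U)] (mod p)"
    if ab: "a \<in> V" "b \<in> V" "a \<noteq> b" and U: "U \<subseteq> V - {a, b}" "card U = t" for a b U
  proof -
    define g where "g U = f (insert a U) - f (insert b U)" for U
    have card_V: "card (V - {a, b}) + 2 = card V"
      using ab Suc.prems(1,3) k by simp
    have sum_g: "p dvd (\<Sum>T | T \<subseteq> S \<and> card T = t. g T)"
      if S: "S \<subseteq> V - {a, b}" "card S = l" for S
    proof -
      have fin: "finite S" and notin: "a \<notin> S" "b \<notin> S"
        using S Suc.prems(1) finite_subset by auto
      have "p dvd (\<Sum>T | T \<subseteq> insert x S \<and> card T = Suc t. f T)" if "x \<in> {a, b}" for x
        using that S ab k fin notin by (intro Suc.prems(5)) auto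
      then have "p dvd (\<Sum>T | T \<subseteq> insert a S \<and> card T = Suc t. f T) -
          (\<Sum>T | T \<subseteq> insert b S \<and> card T = Suc t. f T)"
        by (intro dvd_diff) auto
      \<comment> \<open>The sets avoiding both \<open>a\<close> and \<open>b\<close> occur in both
        sums and cancel; the others pair up as \<open>insert a T\<close> and
        \<open>insert b T\<close>.\<close>
      also have "\<dots> = (\<Sum>T | T \<subseteq> S \<and> card T = t. g T)"
        using fin notin by (simp add: sum_subsets_insert g_def sum_subtractf)
      finally show ?thesis .
    qed
    have g_const: "[g T = g U] (mod p)" if "T \<subseteq> V - {a, b}" "card T = t" for T
    proof (rule Suc.IH[of "V - {a, b}" l])
      \<comment> \<open>With \<open>l = k - 1\<close>, index \<open>i\<close> of the smaller
        instance is index \<open>i + 1\<close> of the original one.\<close>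
      show "\<not> p dvd int ((l - i) choose (t - i))" if "1 \<le> i" "i \<le> t" for i
        using Suc.prems(4)[of "Suc i"] that k by simp
    qed (use that U card_V k Suc.prems(1,3) sum_g in auto)
    \<comment> \<open>One \<open>l\<close>-set suffices to evaluate the constant: its vanishing sum
      is \<open>l choose t\<close> times \<open>g U\<close>, and this binomial is the case
      \<open>i = 1\<close> of the hypothesis, hence prime to \<open>p\<close>.\<close>
    obtain S where S: "S \<subseteq> V - {a, b}" "card S = l"
      using obtain_subset_with_card_n[of l "V - {a, b}"] card_V Suc.prems(3) k by auto
    have "finite S"
      using S Suc.prems(1) finite_subset by auto
    then have "[(\<Sum>T | T \<subseteq> S \<and> card T = t. g T) = int (l choose t) * g U] (mod p)"
      using sum_subsets_cong_const[of S t g "g U" p] g_const S by auto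
    then have "p dvd int (l choose t) * g U"
      using sum_g[OF S] by (simp add: cong_dvd_iff)
    then have "p dvd g U"
      using assms(1) Suc.prems(4)[of 1] k by (auto simp: prime_dvd_mult_iff)
    then show ?thesis
      by (simp add: g_def cong_iff_dvd_diff)
  qed
  show ?case
    by (rule cong_on_subsets_if_exchange[OF Suc.prems(1,6,7)])
      (use Suc.prems(8,9) in \<open>auto intro: exchange\<close>)
qed

text \<open>Once \<open>f\<close> is constant modulo \<open>p\<close>, its sum over a single
  \<open>k\<close>-set is \<open>k choose t\<close> times the constant. The case
  \<open>i = 0\<close> of \<open>binom\<close> then forces the constant to vanish.\<close>

lemma inclusion_kernel_trivial:
  fixes f :: "'a set \<Rightarrow> int" and p :: int
  assumes "prime p" "finite V" "t \<le> k" "k + t \<le> card V"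
    and binom: "\<And>i. i \<le> t \<Longrightarrow> \<not> p dvd int ((k - i) choose (t - i))"
    and sums: "\<And>K. K \<subseteq> V \<Longrightarrow> card K = k \<Longrightarrow> p dvd (\<Sum>T | T \<subseteq> K \<and> card T = t. f T)"
    and A: "A \<subseteq> V" "card A = t"
  shows "p dvd f A"
proof -
  have "k \<le> card V"
    using assms(4) by simp
  then obtain K where K: "K \<subseteq> V" "card K = k" "finite K"
    by (rule obtain_subset_with_card_n)
  have "[f T = f A] (mod p)" if "T \<subseteq> K" "card T = t" for T
  proof (rule inclusion_kernel_cong_const[OF assms(1-4) _ sums])
    show "T \<subseteq> V"
      using that(1) K(1) by blast
  qed (simp_all add: that(2) A binom)
  then have "[(\<Sum>T | T \<subseteq> K \<and> card T = t. f T) = int (k choose t) * f A] (mod p)"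
    using sum_subsets_cong_const[of K t f "f A" p] K by auto
  then have "p dvd int (k choose t) * f A"
    using sums[OF K(1,2)] by (simp add: cong_dvd_iff)
  then show ?thesis
    using assms(1) binom[of 0] by (auto simp: prime_dvd_mult_iff)
qed

section \<open>Induced subgraphs and decomposable 4-sets\<close>

lemma induce_subgraph_induce_subgraph:
  assumes "T \<subseteq> K"
  shows "(G \<restriction> K) \<restriction> T = G \<restriction> T"
  using assms unfolding induce_subgraph_def by auto

lemma dominates_induce_subgraph_iff:
  "u \<rightarrow>\<^bsub>G \<restriction> S\<^esub> v \<longleftrightarrow> u \<in> S \<and> v \<in> S \<and> u \<rightarrow>\<^bsub>G\<^esub> v"
  by (auto simp: arcs_ends_def arc_to_ends_def)

text \<open>For \<open>T \<subseteq> K\<close> the graph induced on \<open>T\<close> does not depend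
  on \<open>K\<close>, so all these counts are sums of one indicator function. This is what makes
  the inclusion lemmas applicable.\<close>

lemma p4_induce_subgraph:
  assumes "K \<subseteq> verts G" "finite K"
  shows "int (p4 (G \<restriction> K)) =
    (\<Sum>T | T \<subseteq> K \<and> card T = 4. of_bool (T \<in> indecomposable_sets4 G))"
proof -
  have "indecomposable_sets4 (G \<restriction> K) =
      {T. T \<subseteq> K \<and> card T = 4} \<inter> {T. T \<in> indecomposable_sets4 G}"
    using assms(1) by (auto simp: indecomposable_sets4_def induce_subgraph_induce_subgraph)
  then show ?thesis
    using assms(2) by (simp add: p4_def)
qed

text \<open>By pigeonhole, two of \<open>a\<close>, \<open>b\<close>, \<open>c\<close> have the same
  adjacency to \<open>d\<close>. They also agree on the third vertex of the triple, so they form an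
  interval of size 2.\<close>

lemma decomposable_if_homogeneous_triple:
  assumes "graph G" "distinct [a, b, c, d]"
    and homogeneous: "(a \<rightarrow>\<^bsub>G\<^esub> b \<and> a \<rightarrow>\<^bsub>G\<^esub> c \<and> b \<rightarrow>\<^bsub>G\<^esub> c) \<or> \<not> (a \<rightarrow>\<^bsub>G\<^esub> b \<or> a \<rightarrow>\<^bsub>G\<^esub> c \<or> b \<rightarrow>\<^bsub>G\<^esub> c)"
  shows "decomposable (G \<restriction> {a, b, c, d})"
proof -
  interpret graph G by fact
  have sym: "u \<rightarrow>\<^bsub>G\<^esub> v \<longleftrightarrow> v \<rightarrow>\<^bsub>G\<^esub> u" for u v
    using sym_arcs by (auto simp: symmetric_def dest: symD)
  let ?H = "G \<restriction> {a, b, c, d}"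
  have "\<exists>I \<in> {{a, b}, {a, c}, {b, c}}. interval ?H I"
    using homogeneous assms(2) sym[of a b] sym[of a c] sym[of b c]
    unfolding interval_def by (auto simp: dominates_induce_subgraph_iff)
  moreover have "\<not> trivial_interval ?H I" if "I \<in> {{a, b}, {a, c}, {b, c}}" for I
    using that assms(2) by (auto simp: trivial_interval_def)
  ultimately show ?thesis
    unfolding indecomposable_def by blast
qed

text \<open>This is the usual argument for the Ramsey number R(3,3): some vertex \<open>x\<close>
  has three neighbours or three non-neighbours, and together with \<open>x\<close> these contain a
  triangle or an independent triple.\<close>

lemma ex_decomposable_set4:
  assumes "graph G" "7 \<le> card (verts G)"
  shows "\<exists>T. T \<subseteq> verts G \<and> card T = 4 \<and> decomposable (G \<restriction> T)"
proof -
  interpret graph G by fact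
  have "verts G \<noteq> {}"
    using assms(2) by auto
  then obtain x where x: "x \<in> verts G" by blast
  define N M where "N = {y \<in> verts G - {x}. x \<rightarrow>\<^bsub>G\<^esub> y}"
    and "M = {y \<in> verts G - {x}. \<not> x \<rightarrow>\<^bsub>G\<^esub> y}"
  have fin: "finite N" "finite M" and disj: "N \<inter> M = {}" and union: "N \<union> M = verts G - {x}"
    by (auto simp: N_def M_def)
  have "card N + card M = card (verts G - {x})"
    using card_Un_disjoint[OF fin disj] union by simp
  then have "card N \<ge> 3 \<or> card M \<ge> 3"
    using assms(2) card_Diff_singleton[OF x] by linarith
  then obtain W where "card W = 3" and W: "W \<subseteq> N \<or> W \<subseteq> M"
    by (metis obtain_subset_with_card_n)
  then obtain a b c where abc: "W = {a, b, c}" "distinct [a, b, c]"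
    by (auto simp: card_3_iff)
  have W_verts: "W \<subseteq> verts G - {x}"
    using W union by blast
  let ?hom = "\<lambda>u v w. (u \<rightarrow>\<^bsub>G\<^esub> v \<and> u \<rightarrow>\<^bsub>G\<^esub> w \<and> v \<rightarrow>\<^bsub>G\<^esub> w) \<or> \<not> (u \<rightarrow>\<^bsub>G\<^esub> v \<or> u \<rightarrow>\<^bsub>G\<^esub> w \<or> v \<rightarrow>\<^bsub>G\<^esub> w)"
  \<comment> \<open>Each of the four triples in \<open>{x, a, b, c}\<close> is brought to the front
    once, with the remaining vertex last.\<close>
  have dist: "distinct [a, b, c, x]" "distinct [x, a, b, c]" "distinct [x, a, c, b]"
    "distinct [x, b, c, a]"
    using abc W_verts by auto
  have perm: "{a, b, c, x} = {x, a, b, c}" "{x, a, c, b} = {x, a, b, c}"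
    "{x, b, c, a} = {x, a, b, c}"
    by auto
  \<comment> \<open>If \<open>W \<subseteq> N\<close>, an edge inside \<open>W\<close> forms a
    triangle with \<open>x\<close>; without such an edge \<open>W\<close> is independent. The case
    \<open>W \<subseteq> M\<close> is dual.\<close>
  have "?hom a b c \<or> ?hom x a b \<or> ?hom x a c \<or> ?hom x b c"
    using W abc(1) by (auto simp: N_def M_def)
  then have "decomposable (G \<restriction> {x, a, b, c})"
    using decomposable_if_homogeneous_triple[OF assms(1) dist(1)]
      decomposable_if_homogeneous_triple[OF assms(1) dist(2)]
      decomposable_if_homogeneous_triple[OF assms(1) dist(3)]
      decomposable_if_homogeneous_triple[OF assms(1) dist(4)]
    unfolding perm by argo
  moreover have "{x, a, b, c} \<subseteq> verts G" "card {x, a, b, c} = 4"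
    using abc W_verts x by auto
  ultimately show ?thesis by blast
qed

section \<open>Divisibility of the binomials that occur for 4-sets\<close>

text \<open>Here \<open>n\<close> stands for \<open>k - 4\<close>, which avoids truncated
  subtraction; multiplying out the factorials avoids division.\<close>

lemma binomial_2_3_4_eq:
  fixes n :: nat
  shows "2 * ((n + 2) choose 2) = (n + 2) * (n + 1)"
    and "6 * ((n + 3) choose 3) = (n + 3) * (n + 2) * (n + 1)"
    and "24 * ((n + 4) choose 4) = (n + 4) * (n + 3) * (n + 2) * (n + 1)"
proof -
  have 2: "2 * ((n + 2) choose 2) = (n + 2) * (n + 1)"
    using Suc_times_binomial_eq[of "n + 1" 1] by (simp add: numeral_2_eq_2)
  have 3: "(n + 3) * ((n + 2) choose 2) = 3 * ((n + 3) choose 3)"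
    using Suc_times_binomial_eq[of "n + 2" 2] by (simp add: eval_nat_numeral)
  have 4: "(n + 4) * ((n + 3) choose 3) = 4 * ((n + 4) choose 4)"
    using Suc_times_binomial_eq[of "n + 3" 3] by (simp add: eval_nat_numeral)
  show "2 * ((n + 2) choose 2) = (n + 2) * (n + 1)"
    by (fact 2)
  have "6 * ((n + 3) choose 3) = (n + 3) * (2 * ((n + 2) choose 2))"
    using 3 by simp
  also have "\<dots> = (n + 3) * (n + 2) * (n + 1)"
    unfolding 2 by (simp only: mult.assoc)
  finally show 6: "6 * ((n + 3) choose 3) = (n + 3) * (n + 2) * (n + 1)" .
  have "24 * ((n + 4) choose 4) = (n + 4) * (6 * ((n + 3) choose 3))"
    using 4 by simp
  also have "\<dots> = (n + 4) * (n + 3) * (n + 2) * (n + 1)"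
    unfolding 6 by (simp only: mult.assoc)
  finally show "24 * ((n + 4) choose 4) = (n + 4) * (n + 3) * (n + 2) * (n + 1)" .
qed

text \<open>A prime dividing one of the binomials would divide the corresponding product in
  \<open>binomial_2_3_4_eq\<close>, hence one of its factors.\<close>

lemma not_prime_dvd_binomials:
  fixes p n :: nat
  assumes "prime p" "\<not> p dvd n + 1" "\<not> p dvd n + 2" "\<not> p dvd n + 3"
  shows "\<not> p dvd (n + 2) choose 2" "\<not> p dvd (n + 3) choose 3"
proof -
  have "\<not> p dvd (n + 2) * (n + 1)" "\<not> p dvd (n + 3) * (n + 2) * (n + 1)"
    using assms by (auto simp only: prime_dvd_mult_iff)
  then show "\<not> p dvd (n + 2) choose 2" "\<not> p dvd (n + 3) choose 3"
    by (metis binomial_2_3_4_eq(1,2) dvd_mult)+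
qed

text \<open>The denominators 2, 6, 24 contain the powers 2, 2, 8 of two. In the numerators,
  \<open>n + 2\<close> contributes exactly one factor 2 and \<open>n + 4\<close> contributes exactly
  4 unless 8 divides it, so only odd factors remain.\<close>

lemma odd_binomials:
  fixes n :: nat
  assumes "4 dvd n"
  shows "odd ((n + 2) choose 2)" "odd ((n + 3) choose 3)"
    and "\<not> 8 dvd n + 4 \<Longrightarrow> odd ((n + 4) choose 4)"
proof -
  obtain m l where m: "n + 4 = 4 * m" and l: "n + 2 = 2 * l" "odd l"
  proof
    show "n + 4 = 4 * (n div 4 + 1)" "n + 2 = 2 * (2 * (n div 4) + 1)"
      using assms by auto
  qed simp
  have n: "odd (n + 1)" "odd (n + 3)"
    using assms by auto
  have "2 * ((n + 2) choose 2) = 2 * (l * (n + 1))"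
    using binomial_2_3_4_eq(1)[of n] unfolding l(1) by (simp only: mult.assoc)
  then have "(n + 2) choose 2 = l * (n + 1)"
    by linarith
  then show "odd ((n + 2) choose 2)"
    using l(2) n by simp
  have "2 * (3 * ((n + 3) choose 3)) = 2 * ((n + 3) * l * (n + 1))"
    using binomial_2_3_4_eq(2)[of n] unfolding l(1) by linarith
  then have "3 * ((n + 3) choose 3) = (n + 3) * l * (n + 1)"
    by linarith
  moreover have "odd ((n + 3) * l * (n + 1))"
    using l(2) n by simp
  ultimately show "odd ((n + 3) choose 3)"
    by (metis dvd_mult)
  assume "\<not> 8 dvd n + 4"
  then have "odd m"
    using m by presburger
  \<comment> \<open>The 8 cancels against the 4 in \<open>n + 4\<close> and the 2 in
    \<open>n + 2\<close>; the remaining 3 does no harm, since a divisor of the binomial also divides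
    its multiples.\<close>
  have "8 * (3 * ((n + 4) choose 4)) = 8 * (m * (n + 3) * l * (n + 1))"
    using binomial_2_3_4_eq(3)[of n] unfolding m l(1) by linarith
  then have "3 * ((n + 4) choose 4) = m * (n + 3) * l * (n + 1)"
    by linarith
  moreover have "odd (m * (n + 3) * l * (n + 1))"
    using l(2) n \<open>odd m\<close> by simp
  ultimately show "odd ((n + 4) choose 4)"
    by (metis dvd_mult)
qed

text \<open>Among the factors only \<open>n + 3\<close> is divisible by 3, and exactly once; this
  cancels the single 3 in the denominators 6 and 24.\<close>

lemma not_3_dvd_binomials:
  fixes n :: nat
  assumes "3 dvd n + 3" "\<not> 9 dvd n + 3"
  shows "\<not> 3 dvd (n + 2) choose 2" "\<not> 3 dvd (n + 3) choose 3" "\<not> 3 dvd (n + 4) choose 4"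
proof -
  obtain j where j: "n + 3 = 3 * j"
    using assms(1) by blast
  have prime_3: "prime (3 :: nat)" by simp
  have "\<not> 3 dvd j" "\<not> 3 dvd n + 1" "\<not> 3 dvd n + 2" "\<not> 3 dvd n + 4"
    using assms(2) j by presburger+
  then have not_dvd: "\<not> 3 dvd (n + 2) * (n + 1)" "\<not> 3 dvd j * (n + 2) * (n + 1)"
    "\<not> 3 dvd (n + 4) * j * (n + 2) * (n + 1)"
    by (simp_all only: prime_dvd_mult_iff[OF prime_3] simp_thms)
  have "2 * ((n + 3) choose 3) = j * (n + 2) * (n + 1)"
    using binomial_2_3_4_eq(2)[of n] unfolding j by linarith
  moreover have "8 * ((n + 4) choose 4) = (n + 4) * j * (n + 2) * (n + 1)"
    using binomial_2_3_4_eq(3)[of n] unfolding j by linarith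
  ultimately show "\<not> 3 dvd (n + 2) choose 2" "\<not> 3 dvd (n + 3) choose 3" "\<not> 3 dvd (n + 4) choose 4"
    using not_dvd by (metis binomial_2_3_4_eq(1) dvd_mult)+
qed

lemma atMost_4_cases:
  fixes i :: nat
  assumes "i \<le> 4"
  obtains "i = 0" | "i = 1" | "i = 2" | "i = 3" | "i = 4"
  using assms by linarith

section \<open>Two graphs whose counts on \<open>k\<close>-sets agree modulo
  \<open>p\<close>\<close>

context
  fixes G :: "('a, 'b) pre_digraph" and G' :: "('a, 'c) pre_digraph"
    and V :: "'a set" and p k :: nat
  assumes graphs: "graph G" "graph G'"
    and verts: "verts G = V" "verts G' = V"
    and k: "4 \<le> k" "k + 4 \<le> card V"
    and p: "prime p"
    and p4_cong: "\<And>K. K \<subseteq> V \<Longrightarrow> card K = k \<Longrightarrow> [p4 (G \<restriction> K) = p4 (G' \<restriction> K)] (mod p)"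
begin

private definition diff4 :: "'a set \<Rightarrow> int" where
  "diff4 T = of_bool (T \<in> indecomposable_sets4 G) - of_bool (T \<in> indecomposable_sets4 G')"

private lemma finite_V: "finite V"
  using k(2) card.infinite by fastforce

private lemma sum_diff4:
  assumes "K \<subseteq> V" "card K = k"
  shows "int p dvd (\<Sum>T | T \<subseteq> K \<and> card T = 4. diff4 T)"
proof -
  have "finite K"
    using assms finite_V finite_subset by auto
  then have "(\<Sum>T | T \<subseteq> K \<and> card T = 4. diff4 T) = int (p4 (G \<restriction> K)) - int (p4 (G' \<restriction> K))"
    using assms verts by (simp add: diff4_def sum_subtractf p4_induce_subgraph)
  then show ?thesis
    using p4_cong[OF assms] by (simp add: cong_int_iff[symmetric] cong_iff_dvd_diff)
qed

text \<open>The values of \<open>diff4\<close> are -1, 0 and 1, and a prime divides only 0 among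
  them.\<close>

private lemma dvd_diff4_iff:
  "int p dvd diff4 T \<longleftrightarrow> (T \<in> indecomposable_sets4 G \<longleftrightarrow> T \<in> indecomposable_sets4 G')"
  using p by (auto simp: diff4_def not_prime_unit)

private lemma indecomposable_sets4_eqI:
  assumes "\<And>T. T \<subseteq> V \<Longrightarrow> card T = 4 \<Longrightarrow> int p dvd diff4 T"
  shows "indecomposable_sets4 G = indecomposable_sets4 G'"
proof (rule set_eqI)
  fix T
  show "T \<in> indecomposable_sets4 G \<longleftrightarrow> T \<in> indecomposable_sets4 G'"
  proof (cases "T \<subseteq> V \<and> card T = 4")
    case True
    then show ?thesis
      using assms dvd_diff4_iff by blast
  next
    case False
    then show ?thesis
      unfolding indecomposable_sets4_def verts by blast
  qed
qed

private lemma diff4_cong: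
  assumes "\<not> p dvd (k - 3)" "\<not> p dvd ((k - 2) choose 2)" "\<not> p dvd ((k - 1) choose 3)"
    and "A \<subseteq> V" "B \<subseteq> V" "card A = 4" "card B = 4"
  shows "[diff4 A = diff4 B] (mod int p)"
proof (rule inclusion_kernel_cong_const[of "int p" V 4 k])
  show "\<not> int p dvd int ((k - i) choose (4 - i))" if "1 \<le> i" "i \<le> 4" for i
    \<comment> \<open>The indices 1, 2, 3 give the three assumed binomials; index 4 gives 1, which
      no prime divides.\<close>
    using that(2) by (cases i rule: atMost_4_cases) (use that(1) assms(1-3) p in auto)
qed (use p k finite_V sum_diff4 assms in auto)

lemma indecomposable_sets4_eq_if_binomials:
  assumes "\<not> p dvd (k - 3)" "\<not> p dvd ((k - 2) choose 2)" "\<not> p dvd ((k - 1) choose 3)"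
    "\<not> p dvd (k choose 4)"
  shows "indecomposable_sets4 G = indecomposable_sets4 G'"
proof -
  have "int p dvd diff4 T" if "T \<subseteq> V" "card T = 4" for T
  proof (rule inclusion_kernel_trivial[of "int p" V 4 k])
    show "\<not> int p dvd int ((k - i) choose (4 - i))" if "i \<le> 4" for i
      using that by (cases i rule: atMost_4_cases) (use assms p in auto)
  qed (use that p k finite_V sum_diff4 in auto)
  then show ?thesis
    by (rule indecomposable_sets4_eqI)
qed

lemma indecomposable_sets4_eq_if_ge_5:
  assumes "5 \<le> p" "\<not> p dvd k - 1" "\<not> p dvd k - 2" "\<not> p dvd k - 3"
  shows "indecomposable_sets4 G = indecomposable_sets4 G'"
proof -
  obtain n where n: "k = n + 4"
    using k(1) by (metis add.commute le_Suc_ex)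
  then have shift: "k - 3 = n + 1" "k - 2 = n + 2" "k - 1 = n + 3"
    by auto
  have binom: "\<not> p dvd (k - 3)" "\<not> p dvd ((k - 2) choose 2)" "\<not> p dvd ((k - 1) choose 3)"
    using assms(2-4) not_prime_dvd_binomials[OF p, of n] unfolding shift by simp_all
  have "int p dvd diff4 T" if T: "T \<subseteq> V" "card T = 4" for T
  proof (rule ccontr)
    assume ndvd: "\<not> int p dvd diff4 T"
    \<comment> \<open>Two values of \<open>diff4\<close> differ by at most 2, which is below
      \<open>p\<close>, so congruence becomes equality.\<close>
    have eq: "diff4 S = diff4 T" if "S \<subseteq> V" "card S = 4" for S
    proof (rule ccontr)
      assume "diff4 S \<noteq> diff4 T"
      moreover have "\<bar>diff4 S - diff4 T\<bar> < int p"
        using assms(1) by (auto simp: diff4_def)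
      moreover have "int p dvd diff4 S - diff4 T"
        using diff4_cong[OF binom that(1) T(1) that(2) T(2)] by (simp add: cong_iff_dvd_diff)
      ultimately show False
        using dvd_imp_le_int[of "diff4 S - diff4 T" "int p"] by simp
    qed
    consider "T \<in> indecomposable_sets4 G" "T \<notin> indecomposable_sets4 G'"
      | "T \<notin> indecomposable_sets4 G" "T \<in> indecomposable_sets4 G'"
      using ndvd unfolding dvd_diff4_iff by blast
    \<comment> \<open>The constant is 1 or -1: either every 4-set is indecomposable in
      \<open>G\<close>, or every one is in \<open>G'\<close>. Both contradict
      \<open>ex_decomposable_set4\<close>, as \<open>card V\<close> is at least 8.\<close>
    then consider "\<And>S. S \<subseteq> V \<Longrightarrow> card S = 4 \<Longrightarrow> S \<in> indecomposable_sets4 G"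
      | "\<And>S. S \<subseteq> V \<Longrightarrow> card S = 4 \<Longrightarrow> S \<in> indecomposable_sets4 G'"
    proof cases
      case 1
      have "S \<in> indecomposable_sets4 G" if "S \<subseteq> V" "card S = 4" for S
        using eq[OF that] 1 by (auto simp: diff4_def of_bool_def split: if_splits)
      then show thesis by (rule that(1))
    next
      case 2
      have "S \<in> indecomposable_sets4 G'" if "S \<subseteq> V" "card S = 4" for S
        using eq[OF that] 2 by (auto simp: diff4_def of_bool_def split: if_splits)
      then show thesis by (rule that(2))
    qed
    then show False
    proof cases
      case 1
      obtain S where "S \<subseteq> V" "card S = 4" "decomposable (G \<restriction> S)"
        using ex_decomposable_set4[OF graphs(1)] k verts by auto
      with 1[of S] show False
        by (simp add: indecomposable_sets4_def)
    next
      case 2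
      obtain S where "S \<subseteq> V" "card S = 4" "decomposable (G' \<restriction> S)"
        using ex_decomposable_set4[OF graphs(2)] k verts by auto
      with 2[of S] show False
        by (simp add: indecomposable_sets4_def)
    qed
  qed
  then show ?thesis
    by (rule indecomposable_sets4_eqI)
qed

text \<open>Modulo 2 the values 1 and -1 coincide, so constancy only says that \<open>diff4\<close>
  vanishes everywhere or nowhere. Vanishing nowhere is the complementary alternative.\<close>

lemma indecomposable_sets4_eq_or_complementary:
  assumes "p = 2" "4 dvd k"
  shows "indecomposable_sets4 G = indecomposable_sets4 G' \<or>
    (\<forall>T. T \<subseteq> V \<and> card T = 4 \<longrightarrow> (indecomposable (G \<restriction> T) \<longleftrightarrow> decomposable (G' \<restriction> T)))"
proof -
  obtain n where n: "k = n + 4" "4 dvd n"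
    using k(1) assms(2) by (metis add.commute le_Suc_ex dvd_add_triv_left_iff)
  then have shift: "k - 3 = n + 1" "k - 2 = n + 2" "k - 1 = n + 3"
    by auto
  have "odd (n + 1)"
    using n(2) by presburger
  then have binom: "\<not> p dvd (k - 3)" "\<not> p dvd ((k - 2) choose 2)" "\<not> p dvd ((k - 1) choose 3)"
    using odd_binomials(1,2)[OF n(2)] unfolding shift assms(1) by simp_all
  have "int p dvd diff4 S \<longleftrightarrow> int p dvd diff4 T" if "S \<subseteq> V" "card S = 4" "T \<subseteq> V" "card T = 4" for S T
    by (rule cong_dvd_iff, rule diff4_cong) (use binom that in auto)
  then consider "\<And>T. T \<subseteq> V \<Longrightarrow> card T = 4 \<Longrightarrow> int p dvd diff4 T"
    | "\<And>T. T \<subseteq> V \<Longrightarrow> card T = 4 \<Longrightarrow> \<not> int p dvd diff4 T"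
    by blast
  then show ?thesis
  proof cases
    case 1
    then show ?thesis
      using indecomposable_sets4_eqI by blast
  next
    case 2
    have "indecomposable (G \<restriction> T) \<longleftrightarrow> decomposable (G' \<restriction> T)" if "T \<subseteq> V" "card T = 4" for T
      using 2[OF that] that verts unfolding dvd_diff4_iff by (simp add: indecomposable_sets4_def)
    then show ?thesis by blast
  qed
qed

end

section \<open>Translation of the conditions on \<open>k\<close> and \<open>p\<close>\<close>

theorem theorem4p2:
  fixes G :: "('a, 'b) pre_digraph" and G' :: "('a, 'c) pre_digraph"
    and V :: "'a set" and v p k :: nat
  assumes "graph G" and "graph G'"
    and "verts G = V" and "verts G' = V" and "card V = v"
    and "prime p"
    and "4 \<le> k" and "int k \<le> int v - 4"
  shows
    "((\<forall>K. K \<subseteq> V \<and> card K = k \<longrightarrow> p4 (G \<restriction> K) = p4 (G' \<restriction> K)) \<longrightarrow>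
        indecomposable_sets4 G = indecomposable_sets4 G') \<and>
     ((\<forall>K. K \<subseteq> V \<and> card K = k \<longrightarrow> [p4 (G \<restriction> K) = p4 (G' \<restriction> K)] (mod p)) \<longrightarrow>
        (p \<ge> 5 \<and> \<not> [k = 1] (mod p) \<and> \<not> [k = 2] (mod p) \<and> \<not> [k = 3] (mod p) \<longrightarrow>
          indecomposable_sets4 G = indecomposable_sets4 G') \<and>
        ((p = 2 \<and> 4 dvd k \<and> \<not> 8 dvd k) \<or> (p = 3 \<and> 3 dvd (k - 1) \<and> \<not> 9 dvd (k - 1)) \<longrightarrow>
          indecomposable_sets4 G = indecomposable_sets4 G') \<and>
        (p = 2 \<and> 8 dvd k \<longrightarrow>
          indecomposable_sets4 G = indecomposable_sets4 G' \<or>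
          (\<forall>T. T \<subseteq> V \<and> card T = 4 \<longrightarrow>
            (indecomposable (G \<restriction> T) \<longleftrightarrow> decomposable (G' \<restriction> T)))))"
proof -
  have kv: "k + 4 \<le> card V"
    using assms(5,8) by linarith
  obtain n where n: "k = n + 4"
    using assms(7) by (metis add.commute le_Suc_ex)
  have cong_k: "[k = i] (mod q) \<longleftrightarrow> q dvd k - i" if "i < 4" for q i
    using that n cong_altdef_nat[of i k q] by simp
  have shift: "k - 3 = n + 1" "k - 2 = n + 2" "k - 1 = n + 3"
    using n by auto
  note setting = assms(1-4,7) kv
  show ?thesis
  proof (intro conjI impI)
    assume eq: "\<forall>K. K \<subseteq> V \<and> card K = k \<longrightarrow> p4 (G \<restriction> K) = p4 (G' \<restriction> K)"
    \<comment> \<open>Equal counts are congruent modulo every prime. A prime above \<open>k\<close>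
      is at least 5 and exceeds the positive numbers \<open>k - 1\<close>, \<open>k - 2\<close>,
      \<open>k - 3\<close>, so it divides none of them.\<close>
    obtain q where q: "prime q" "k < q"
      using bigger_prime by blast
    show "indecomposable_sets4 G = indecomposable_sets4 G'"
      by (rule indecomposable_sets4_eq_if_ge_5[OF setting q(1)])
        (use eq q n in \<open>auto dest: dvd_imp_le\<close>)
  next
    assume "\<forall>K. K \<subseteq> V \<and> card K = k \<longrightarrow> [p4 (G \<restriction> K) = p4 (G' \<restriction> K)] (mod p)"
    then have cong: "[p4 (G \<restriction> K) = p4 (G' \<restriction> K)] (mod p)" if "K \<subseteq> V" "card K = k" for K
      using that by blast
    {
      assume "p \<ge> 5 \<and> \<not> [k = 1] (mod p) \<and> \<not> [k = 2] (mod p) \<and> \<not> [k = 3] (mod p)"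
      then show "indecomposable_sets4 G = indecomposable_sets4 G'"
        using indecomposable_sets4_eq_if_ge_5[OF setting assms(6) cong] by (simp add: cong_k)
    next
      assume p: "(p = 2 \<and> 4 dvd k \<and> \<not> 8 dvd k) \<or> (p = 3 \<and> 3 dvd (k - 1) \<and> \<not> 9 dvd (k - 1))"
      have "\<not> p dvd n + 1" "\<not> p dvd (n + 2) choose 2" "\<not> p dvd (n + 3) choose 3"
          "\<not> p dvd (n + 4) choose 4"
        using p
      proof (atomize (full), elim disjE conjE, goal_cases)
        case 1
        then have "4 dvd n" "\<not> 8 dvd n + 4"
          by (simp_all add: n)
        then show ?case
          using odd_binomials[of n] unfolding 1(1) by auto
      next
        case 2
        have "k - 1 = n + 3"
          by (simp add: n)
        \<comment> \<open>The condition on \<open>k - 1\<close> is one on \<open>n + 3\<close>, and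
          \<open>n + 1 = k - 3\<close> is then not a multiple of 3.\<close>
        then have "3 dvd n + 3" "\<not> 9 dvd n + 3" "\<not> 3 dvd n + 1"
          using 2(2,3) by presburger+
        then show ?case
          using not_3_dvd_binomials[of n] unfolding 2(1) by blast
      qed
      then show "indecomposable_sets4 G = indecomposable_sets4 G'"
        using indecomposable_sets4_eq_if_binomials[OF setting assms(6) cong]
        unfolding shift n[symmetric] by blast
    next
      assume "p = 2 \<and> 8 dvd k"
      moreover from this have "4 dvd k"
        by presburger
      ultimately show "indecomposable_sets4 G = indecomposable_sets4 G' \<or>
          (\<forall>T. T \<subseteq> V \<and> card T = 4 \<longrightarrow> (indecomposable (G \<restriction> T) \<longleftrightarrow> decomposable (G' \<restriction> T)))"
        using indecomposable_sets4_eq_or_complementary[OF setting assms(6) cong] by blast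
    }
  qed
qed

end
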